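(* Let $j \ge k$ be positive integers. For any bipartite digraph $D$ whose longest dipath has length $2$, we have $\vec{\lambda}_{j,k}(D) = j+k$.
   Context: All digraphs are finite and strongly simple: they have no loops, no multiple edges, and never contain both edges $xy$ and $yx$. In a digraph $D$, $xy\in E(D)$ denotes an edge directed from $x$ to $y$, and then $x$ is adjacent to $y$. A dipath of length $\ell$ is a sequence of $\ell+1$ distinct vertices $v_0,v_1,\dots,v_\ell$ with $v_iv_{i+1}\in E(D)$ for all $0\le i<\ell$. "The longest dipath has length $m$" means that the maximum length of a dipath in $D$ is $m$. The distance $d_D(x,y)$ is the length of a shortest dipath from $x$ to $y$ (if one exists). For positive integers $j\ge k$, an $L(j,k)$-labeling of $D$ is a function $f$ from $V(D)$ to the nonnegative integers such that $|f(x)-f(y)|\ge j$ whenever $xy\in E(D)$ and $|f(x)-f(y)|\ge k$ whenever $d_D(x,y)=2$. The number $\vec{\lambda}_{j,k}(D)$ is the minimum, over all $L(j,k)$-labelings $f$ of $D$, of the span of $f$ (largest label minus smallest label). Equivalently, it is the minimum over all $L(j,k)$-labelings of the maximum label used. A digraph is bipartite if its underlying (undirected) graph is bipartite. *)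

theory Defs
  imports "Graph_Theory.Shortest_Path"
begin

locale strongly_simple_digraph = digraph +
  assumes no_antiparallel_arcs: "x \<rightarrow>\<^bsub>G\<^esub> y \<Longrightarrow> \<not> y \<rightarrow>\<^bsub>G\<^esub> x"

text \<open>
  A dipath is an \<^const>\<open>pre_digraph.apath\<close>, given by its list of arcs, so that its length is the
  length of that list. The predicate below is false for the null digraph, which has no dipaths.
\<close>

definition longest_dipath_length :: "('a, 'b) pre_digraph \<Rightarrow> nat \<Rightarrow> bool" where
  "longest_dipath_length D m \<longleftrightarrow>
     (\<exists>u p v. pre_digraph.apath D u p v \<and> length p = m) \<and>
     (\<forall>u p v. pre_digraph.apath D u p v \<longrightarrow> length p \<le> m)"

definition dipath_dist :: "('a, 'b) pre_digraph \<Rightarrow> 'a \<Rightarrow> 'a \<Rightarrow> enat" where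
  "dipath_dist D x y = (INF p \<in> {p. pre_digraph.apath D x p y}. enat (length p))"

definition underlying_edges :: "('a, 'b) pre_digraph \<Rightarrow> 'a set set" where
  "underlying_edges D = (\<lambda>e. {tail D e, head D e}) ` arcs D"

definition bipartite_digraph :: "('a, 'b) pre_digraph \<Rightarrow> bool" where
  "bipartite_digraph D \<longleftrightarrow>
     (\<exists>A B. A \<union> B = verts D \<and> A \<inter> B = {} \<and>
            (\<forall>E \<in> underlying_edges D. \<exists>a \<in> A. \<exists>b \<in> B. E = {a, b}))"

definition L_labeling :: "nat \<Rightarrow> nat \<Rightarrow> ('a, 'b) pre_digraph \<Rightarrow> ('a \<Rightarrow> nat) \<Rightarrow> bool" where
  "L_labeling j k D f \<longleftrightarrow>
     (\<forall>x \<in> verts D. \<forall>y \<in> verts D.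
        (x \<rightarrow>\<^bsub>D\<^esub> y \<longrightarrow> \<bar>int (f x) - int (f y)\<bar> \<ge> int j) \<and>
        (dipath_dist D x y = 2 \<longrightarrow> \<bar>int (f x) - int (f y)\<bar> \<ge> int k))"

definition label_span :: "('a, 'b) pre_digraph \<Rightarrow> ('a \<Rightarrow> nat) \<Rightarrow> nat" where
  "label_span D f = Max (f ` verts D) - Min (f ` verts D)"

definition L_lambda :: "nat \<Rightarrow> nat \<Rightarrow> ('a, 'b) pre_digraph \<Rightarrow> nat" where
  "L_lambda j k D = (LEAST s. \<exists>f. L_labeling j k D f \<and> label_span D f = s)"


text \<open>The distance agrees with the library's shortest-path distance for unit weights.\<close>

lemma (in fin_digraph) dipath_dist_conv_\<mu>:
  "ereal_of_enat (dipath_dist G x y) = \<mu> (\<lambda>_. 1) x y"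
proof (cases "x \<rightarrow>\<^sup>* y")
  case True
  have cost: "awalk_cost (\<lambda>_. 1) p = real (length p)" for p
    by (induct p) auto
  obtain p where p: "apath x p y" and \<mu>: "\<mu> (\<lambda>_. 1) x y = ereal (real (length p))"
    using min_cost_awalk[OF True, of "\<lambda>_. 1"] cost by auto
  have "length p \<le> length q" if "apath x q y" for q
    using min_cost_le_walk_cost[of x q y "\<lambda>_. 1"] that \<mu> cost
    by (simp add: apath_def)
  then have "dipath_dist G x y = enat (length p)"
    unfolding dipath_dist_def using p
    by (intro antisym INF_lower2[of p] INF_greatest) auto
  then show ?thesis using \<mu> by simp
next
  case False
  then have "{p. apath x p y} = {}"
    by (auto simp: reachable_awalk apath_def)
  then have "dipath_dist G x y = \<infinity>"
    by (simp add: dipath_dist_def top_enat_def)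
  then show ?thesis using shortest_path_inf[OF False] by simp
qed

text \<open>Labelings exist, so the minimum defining the labeling number is attained.\<close>

lemma L_lambda_attained:
  assumes "strongly_simple_digraph D"
  shows "\<exists>f. L_labeling j k D f \<and> label_span D f = L_lambda j k D"
proof -
  interpret strongly_simple_digraph D by fact
  obtain h :: "'a \<Rightarrow> nat" where h: "inj_on h (verts D)"
    using finite_imp_inj_to_nat_seg[OF finite_verts] by blast
  define f where "f x = (j + k) * h x" for x
  have gap: "int (j + k) \<le> \<bar>int (f x) - int (f y)\<bar>"
    if "x \<in> verts D" "y \<in> verts D" "x \<noteq> y" for x y
  proof -
    have "h x \<noteq> h y" using h that by (auto dest: inj_onD)
    then have "1 \<le> \<bar>int (h x) - int (h y)\<bar>" by linarith
    then have "int (j + k) * 1 \<le> int (j + k) * \<bar>int (h x) - int (h y)\<bar>"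
      by (rule mult_left_mono) simp
    also have "\<dots> = \<bar>int (f x) - int (f y)\<bar>"
      unfolding f_def by (simp add: abs_mult flip: right_diff_distrib)
    finally show ?thesis by simp
  qed
  have "L_labeling j k D f"
    unfolding L_labeling_def
  proof (intro ballI conjI impI)
    fix x y assume xy: "x \<in> verts D" "y \<in> verts D"
    { assume "x \<rightarrow>\<^bsub>D\<^esub> y"
      then have "x \<noteq> y" using adj_not_same by blast
      then show "int j \<le> \<bar>int (f x) - int (f y)\<bar>" using gap[OF xy] by simp }
    { assume d: "dipath_dist D x y = 2"
      have "x \<noteq> y"
      proof
        assume "x = y"
        then have "apath x [] y" using xy by (simp add: apath_Nil_iff)
        then have "dipath_dist D x y \<le> enat (length ([] :: 'b list))"
          unfolding dipath_dist_def by (intro INF_lower) simp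
        then show False using d by (simp add: zero_enat_def[symmetric])
      qed
      then show "int k \<le> \<bar>int (f x) - int (f y)\<bar>" using gap[OF xy] by simp }
  qed
  then have "\<exists>s f. L_labeling j k D f \<and> label_span D f = s" by blast
  then show ?thesis unfolding L_lambda_def by (rule LeastI_ex)
qed

end

theory Submission
  imports Defs
begin

text \<open>
  Only the two-step dipaths \<open>x \<rightarrow> y \<rightarrow> z\<close> matter. In a bipartite digraph the ends of such a dipath
  lie in the same part, so they are not joined by an arc and their distance is exactly \<open>2\<close>.

  Lower bound. Take one such dipath. If \<open>f y\<close> lies between \<open>f x\<close> and \<open>f z\<close>, the labels spread
  over at least \<open>2 * j \<ge> j + k\<close>. Otherwise \<open>f y\<close> is extreme, the nearer of \<open>f x\<close> and \<open>f z\<close> is at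
  least \<open>j\<close> away from it, and the other one at least another \<open>k\<close> beyond that.

  Upper bound. Since no dipath has length \<open>3\<close>, the end \<open>z\<close> of a two-step dipath \<open>x \<rightarrow> y \<rightarrow> z\<close> is
  always a sink, whereas \<open>x\<close> is not. So one bit per vertex, being a sink or not, separates
  all pairs at distance \<open>2\<close>, and the bipartition separates the adjacent pairs. With parts \<open>A\<close> and
  \<open>B\<close>, the non-sinks of \<open>A\<close> get \<open>0\<close>, its sinks \<open>k\<close>, the sinks of \<open>B\<close> get \<open>j\<close>, its non-sinks
  \<open>j + k\<close>. The only labels in different parts that are too close are \<open>k\<close> and \<open>j\<close>, and two sinks
  are never adjacent.
\<close>

section \<open>Dipaths and distance two\<close>

lemma (in wf_digraph) apath_of_vertex_list:
  assumes "vs \<noteq> []" "distinct vs" "set vs \<subseteq> verts G" "successively (\<lambda>x y. x \<rightarrow>\<^bsub>G\<^esub> y) vs"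
  shows "\<exists>p. apath (hd vs) p (last vs) \<and> length vs = Suc (length p)"
proof -
  have "\<exists>p. awalk (hd vs) p (last vs) \<and> awalk_verts (hd vs) p = vs"
    using assms(1,3,4)
  proof (induction vs rule: induct_list012)
    case (3 x y zs)
    obtain p where p: "awalk y p (last (y # zs))" "awalk_verts y p = y # zs"
      using 3 by auto
    obtain e where "e \<in> arcs G" "tail G e = x" "head G e = y"
      using 3 by auto
    with p have "awalk x (e # p) (last (y # zs))" "awalk_verts x (e # p) = x # y # zs"
      by (auto simp: awalk_Cons_iff)
    then show ?case by auto
  qed (auto simp: awalk_Nil_iff intro!: exI[of _ "[]"])
  then obtain p where p: "awalk (hd vs) p (last vs)" "awalk_verts (hd vs) p = vs" by blast
  then show ?thesis using assms(2) by (metis apath_def length_awalk_verts)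
qed

lemma (in wf_digraph) apath_length_2D:
  assumes "apath x p z" "length p = 2"
  shows "\<exists>y. x \<rightarrow>\<^bsub>G\<^esub> y \<and> y \<rightarrow>\<^bsub>G\<^esub> z"
proof -
  obtain a b where "p = [a, b]"
    using assms(2) by (auto simp: numeral_2_eq_2 length_Suc_conv)
  with assms(1) show ?thesis
    by (auto simp: apath_def awalk_Cons_iff awalk_Nil_iff intro!: in_arcs_imp_in_arcs_ends)
qed

lemma dipath_dist_eqD:
  assumes "dipath_dist D x y = enat n"
  shows "\<exists>p. pre_digraph.apath D x p y \<and> length p = n"
proof -
  let ?S = "(\<lambda>p. enat (length p)) ` {p. pre_digraph.apath D x p y}"
  have "Inf ?S = enat n" using assms unfolding dipath_dist_def .
  then have "?S \<noteq> {}" by (metis Inf_empty enat.distinct(1) top_enat_def)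
  then have "Inf ?S \<in> ?S"
    by (metis (full_types) Inf_enat_def LeastI ex_in_conv)
  then obtain p where "pre_digraph.apath D x p y" "Inf ?S = enat (length p)" by blast
  then show ?thesis using assms unfolding dipath_dist_def by auto
qed

lemma (in wf_digraph) dipath_dist_eq_2I:
  assumes "x \<rightarrow>\<^bsub>G\<^esub> y" "y \<rightarrow>\<^bsub>G\<^esub> z" "distinct [x, y, z]" "\<not> x \<rightarrow>\<^bsub>G\<^esub> z"
  shows "dipath_dist G x z = 2"
proof -
  have "x \<in> verts G" "y \<in> verts G" "z \<in> verts G" using assms by auto
  then have "\<exists>p. apath x p z \<and> length p = 2"
    using apath_of_vertex_list[of "[x, y, z]"] assms by fastforce
  moreover have "2 \<le> length p" if "apath x p z" for p
  proof (rule ccontr)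
    assume "\<not> 2 \<le> length p"
    then consider "p = []" | e where "p = [e]"
      by (cases p rule: remdups_adj.cases) auto
    then show False
      using that assms(3,4)
      by cases (auto simp: apath_def awalk_Cons_iff awalk_Nil_iff
                     dest: in_arcs_imp_in_arcs_ends)
  qed
  ultimately show ?thesis
    unfolding dipath_dist_def
    by (intro antisym) (auto simp: numeral_eq_enat intro!: INF_greatest intro: INF_lower2)
qed

lemma bipartite_digraphE:
  assumes "bipartite_digraph D" "wf_digraph D"
  obtains A where "\<And>x y. x \<rightarrow>\<^bsub>D\<^esub> y \<Longrightarrow> (x \<in> A) \<noteq> (y \<in> A)"
proof -
  interpret wf_digraph D by fact
  obtain A B where AB: "A \<inter> B = {}"
    "\<And>E. E \<in> underlying_edges D \<Longrightarrow> \<exists>a\<in>A. \<exists>b\<in>B. E = {a, b}"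
    using assms(1) unfolding bipartite_digraph_def by metis
  have "(x \<in> A) \<noteq> (y \<in> A)" if "x \<rightarrow>\<^bsub>D\<^esub> y" for x y
  proof -
    have "{x, y} \<in> underlying_edges D"
      using that by (auto simp: underlying_edges_def)
    from AB(2)[OF this] show ?thesis
      using AB(1) by (auto simp: doubleton_eq_iff)
  qed
  then show thesis by (rule that)
qed

section \<open>The lower bound\<close>

lemma (in fin_digraph) label_span_ge:
  assumes "x \<in> verts G" "y \<in> verts G"
  shows "int (f x) - int (f y) \<le> int (label_span G f)"
proof -
  have "f x \<le> Max (f ` verts G)" "Min (f ` verts G) \<le> f y"
    using assms by auto
  then show ?thesis unfolding label_span_def by linarith
qed

lemma (in fin_digraph) label_span_lower_bound:
  assumes "L_labeling j k G f" "k \<le> j"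
    and "x \<rightarrow>\<^bsub>G\<^esub> y" "y \<rightarrow>\<^bsub>G\<^esub> z" "dipath_dist G x z = 2"
  shows "j + k \<le> label_span G f"
proof -
  have V: "x \<in> verts G" "y \<in> verts G" "z \<in> verts G" using assms by auto
  have gaps: "int j \<le> \<bar>int (f x) - int (f y)\<bar>" "int j \<le> \<bar>int (f y) - int (f z)\<bar>"
    "int k \<le> \<bar>int (f x) - int (f z)\<bar>"
    using assms V unfolding L_labeling_def by auto
  have spread: "int (f u) - int (f v) \<le> int (label_span G f)"
    if "u \<in> {x, y, z}" "v \<in> {x, y, z}" for u v
    using that V by (intro label_span_ge) auto
  have "int (f x) - int (f y) \<le> int (label_span G f)" "int (f y) - int (f x) \<le> int (label_span G f)"
    "int (f y) - int (f z) \<le> int (label_span G f)" "int (f z) - int (f y) \<le> int (label_span G f)"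
    "int (f x) - int (f z) \<le> int (label_span G f)" "int (f z) - int (f x) \<le> int (label_span G f)"
    by (rule spread; simp)+
  then show ?thesis using gaps assms(2) by linarith
qed

section \<open>The sink labeling\<close>

definition is_sink :: "('a, 'b) pre_digraph \<Rightarrow> 'a \<Rightarrow> bool" where
  "is_sink D x \<longleftrightarrow> \<not> (\<exists>y. x \<rightarrow>\<^bsub>D\<^esub> y)"

definition sink_labeling ::
  "nat \<Rightarrow> nat \<Rightarrow> ('a, 'b) pre_digraph \<Rightarrow> 'a set \<Rightarrow> 'a \<Rightarrow> nat" where
  "sink_labeling j k D A x =
     (if x \<in> A then if is_sink D x then k else 0
      else if is_sink D x then j else j + k)"

text \<open>
  An arc out of \<open>z\<close> would extend \<open>x \<rightarrow> y \<rightarrow> z\<close> to a dipath of length \<open>3\<close>: its head is not \<open>z\<close> or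
  \<open>x\<close>, which are in the part of \<open>z\<close>, and not \<open>y\<close>, as there are no antiparallel arcs.
\<close>

lemma (in strongly_simple_digraph) two_step_head_is_sink:
  assumes "x \<rightarrow>\<^bsub>G\<^esub> y" "y \<rightarrow>\<^bsub>G\<^esub> z"
    and side: "\<And>u v. u \<rightarrow>\<^bsub>G\<^esub> v \<Longrightarrow> (u \<in> A) \<noteq> (v \<in> A)"
    and short: "\<And>u p v. apath u p v \<Longrightarrow> length p \<le> 2"
  shows "is_sink G z"
  unfolding is_sink_def
proof
  assume "\<exists>w. z \<rightarrow>\<^bsub>G\<^esub> w"
  then obtain w where w: "z \<rightarrow>\<^bsub>G\<^esub> w" by blast
  have "distinct [x, y, z, w]"
    using assms(1,2) w side[OF assms(1)] side[OF assms(2)] side[OF w]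
      no_antiparallel_arcs[OF assms(1)] no_antiparallel_arcs[OF assms(2)]
    by auto
  moreover have "x \<in> verts G" "y \<in> verts G" "z \<in> verts G" "w \<in> verts G"
    using assms(1,2) w by auto
  ultimately obtain p where "apath x p w" "length p = 3"
    using apath_of_vertex_list[of "[x, y, z, w]"] assms(1,2) w by fastforce
  then show False using short[of x p w] by simp
qed

lemma (in wf_digraph) L_labeling_sink_labeling:
  assumes side: "\<And>u v. u \<rightarrow>\<^bsub>G\<^esub> v \<Longrightarrow> (u \<in> A) \<noteq> (v \<in> A)"
    and sink: "\<And>x y z. x \<rightarrow>\<^bsub>G\<^esub> y \<Longrightarrow> y \<rightarrow>\<^bsub>G\<^esub> z \<Longrightarrow> is_sink G z"
  shows "L_labeling j k G (sink_labeling j k G A)"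
  unfolding L_labeling_def
proof (intro ballI conjI impI)
  fix x z
  show "int j \<le> \<bar>int (sink_labeling j k G A x) - int (sink_labeling j k G A z)\<bar>"
    if "x \<rightarrow>\<^bsub>G\<^esub> z"
  proof -
    have "\<not> is_sink G x" using that unfolding is_sink_def by blast
    then show ?thesis using side[OF that] by (simp add: sink_labeling_def)
  qed
  show "int k \<le> \<bar>int (sink_labeling j k G A x) - int (sink_labeling j k G A z)\<bar>"
    if dist: "dipath_dist G x z = 2"
  proof -
    obtain y where y: "x \<rightarrow>\<^bsub>G\<^esub> y" "y \<rightarrow>\<^bsub>G\<^esub> z"
      using dipath_dist_eqD[of G x z 2] dist apath_length_2D by (metis numeral_eq_enat)
    have "\<not> is_sink G x" using y(1) unfolding is_sink_def by blast
    then show ?thesis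
      using side[OF y(1)] side[OF y(2)] sink[OF y] by (simp add: sink_labeling_def)
  qed
qed

lemma label_span_sink_labeling:
  assumes "k \<le> j" "finite (verts D)" "verts D \<noteq> {}"
  shows "label_span D (sink_labeling j k D A) \<le> j + k"
proof -
  have "sink_labeling j k D A x \<le> j + k" for x
    using assms(1) by (simp add: sink_labeling_def)
  then have "Max (sink_labeling j k D A ` verts D) \<le> j + k"
    using assms(2,3) by auto
  then show ?thesis unfolding label_span_def by linarith
qed

section \<open>The labeling number\<close>

theorem theorem5:
  fixes D :: "('a, 'b) pre_digraph" and j k :: nat
  assumes "k > 0" and "j \<ge> k"
    and "strongly_simple_digraph D"
    and "bipartite_digraph D"
    and "longest_dipath_length D 2"
  shows "L_lambda j k D = j + k"
proof (rule antisym)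
  interpret strongly_simple_digraph D by fact
  obtain A where side: "\<And>x y. x \<rightarrow>\<^bsub>D\<^esub> y \<Longrightarrow> (x \<in> A) \<noteq> (y \<in> A)"
    using bipartite_digraphE[OF assms(4) wf_digraph_axioms] by blast
  have short: "\<And>u p v. apath u p v \<Longrightarrow> length p \<le> 2"
    using assms(5) unfolding longest_dipath_length_def by blast
  obtain x y z where xyz: "x \<rightarrow>\<^bsub>D\<^esub> y" "y \<rightarrow>\<^bsub>D\<^esub> z"
    using assms(5) apath_length_2D unfolding longest_dipath_length_def by blast
  show "L_lambda j k D \<le> j + k"
  proof -
    let ?f = "sink_labeling j k D A"
    have "L_labeling j k D ?f"
      by (rule L_labeling_sink_labeling[OF side two_step_head_is_sink[OF _ _ side short]])
    then have "L_lambda j k D \<le> label_span D ?f"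
      unfolding L_lambda_def by (intro Least_le) blast
    also have "\<dots> \<le> j + k"
      using adj_in_verts(1)[OF xyz(1)] assms(2) by (intro label_span_sink_labeling) auto
    finally show ?thesis .
  qed
  show "j + k \<le> L_lambda j k D"
  proof -
    have "distinct [x, y, z]"
      using xyz no_antiparallel_arcs[OF xyz(1)] side[OF xyz(1)] side[OF xyz(2)] by auto
    moreover have "\<not> x \<rightarrow>\<^bsub>D\<^esub> z"
      using side[of x z] side[OF xyz(1)] side[OF xyz(2)] by blast
    ultimately have "dipath_dist D x z = 2"
      using xyz by (intro dipath_dist_eq_2I)
    moreover obtain f where "L_labeling j k D f" "label_span D f = L_lambda j k D"
      using L_lambda_attained[OF assms(3)] by blast
    ultimately show ?thesis
      using label_span_lower_bound[of j k f x y z] xyz assms(2) by simp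
  qed
qed

end
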